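(* For every integer $n \geq 2$, let $G_n$ be the graph with vertex set $V(G_n) = \{u_0, \ldots, u_n\} \cup \{x_i, y_i, z_i : 1 \le i \le n-1\}$ (all these vertices distinct) and with exactly the following edges: $u_i u_{i+1}$ for $i \in \{0,\ldots,n-1\}$, and $u_i x_i$, $x_i y_i$, $y_i z_i$, $u_{i+1}x_i$, $u_{i+1}y_i$, $u_{i+1}z_i$ for $i \in \{1,\ldots,n-1\}$. Then $\gamma_{cg}'(G_n) = 2n$.
   Context: The connected domination game on a graph $G$ is played by two players, Dominator and Staller, who alternately select vertices. A vertex $w$ is a legal move if (a) its closed neighborhood $N[w]$ contains at least one vertex not in the union of the closed neighborhoods of the previously selected vertices (i.e. it dominates a new vertex), and (b) unless it is the first move, $w$ is adjacent to at least one already selected vertex. The game ends when no legal move exists; on a connected graph the selected vertices then form a connected dominating set. Dominator wants to minimize the total number of moves, Staller wants to maximize it. $\gamma_{cg}'(G)$ is the number of moves under optimal play when Staller moves first (S-game). *)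

theory Defs
  imports Main
begin

record 'a graph =
  verts :: "'a set"
  edges :: "'a set set"

definition simple_graph :: "'a graph \<Rightarrow> bool" where
  "simple_graph G \<longleftrightarrow> (\<forall>e \<in> edges G. e \<subseteq> verts G \<and> card e = 2)"

definition closed_nbhd :: "'a graph \<Rightarrow> 'a \<Rightarrow> 'a set" where
  "closed_nbhd G v = {w \<in> verts G. w = v \<or> {v, w} \<in> edges G}"

definition dominated :: "'a graph \<Rightarrow> 'a set \<Rightarrow> 'a set" where
  "dominated G S = (\<Union>v \<in> S. closed_nbhd G v)"

(* The position of the game is recorded by the set S of vertices selected so far: legality does
   not depend on their order, and the first condition below excludes repeated moves. *)
definition legal_moves :: "'a graph \<Rightarrow> 'a set \<Rightarrow> 'a set" where
  "legal_moves G S = {w \<in> verts G.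
     \<not> closed_nbhd G w \<subseteq> dominated G S \<and>
     (S \<noteq> {} \<longrightarrow> (\<exists>s \<in> S. {s, w} \<in> edges G))}"

datatype player = Dominator | Staller

(* Number of moves still to be made from position S with p to move, if both play optimally.
   Only finite graphs are intended; for infinite ones the value is the dummy 0, which makes
   the recursion total. *)
function remaining_moves :: "'a graph \<Rightarrow> player \<Rightarrow> 'a set \<Rightarrow> nat" where
  "remaining_moves G p S =
     (if infinite (verts G) \<or> legal_moves G S = {} then 0
      else case p of
        Dominator \<Rightarrow> 1 + Min ((\<lambda>w. remaining_moves G Staller (insert w S)) ` legal_moves G S)
      | Staller \<Rightarrow> 1 + Max ((\<lambda>w. remaining_moves G Dominator (insert w S)) ` legal_moves G S))"
  by pat_completeness auto

lemma undominated_decreases: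
  assumes "finite (verts G)" and "w \<in> legal_moves G S"
  shows "card (verts G - dominated G (insert w S)) < card (verts G - dominated G S)"
proof (rule psubset_card_mono)
  show "finite (verts G - dominated G S)" using assms(1) by simp
  have "closed_nbhd G w \<subseteq> verts G" by (auto simp: closed_nbhd_def)
  moreover have "\<not> closed_nbhd G w \<subseteq> dominated G S"
    using assms(2) by (simp add: legal_moves_def)
  moreover have "dominated G (insert w S) = closed_nbhd G w \<union> dominated G S"
    by (simp add: dominated_def)
  ultimately show "verts G - dominated G (insert w S) \<subset> verts G - dominated G S"
    by blast
qed

termination remaining_moves
  by (relation "measure (\<lambda>(G, p, S). card (verts G - dominated G S))")
     (auto intro: undominated_decreases)

declare remaining_moves.simps [simp del]

definition gamma_cg' :: "'a graph \<Rightarrow> nat" where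
  "gamma_cg' G = remaining_moves G Staller {}"

datatype vertex = U nat | X nat | Y nat | Z nat

definition G_graph :: "nat \<Rightarrow> vertex graph" where
  "G_graph n = \<lparr>
     verts = U ` {0..n} \<union> (\<Union>i \<in> {1..n-1}. {X i, Y i, Z i}),
     edges = (\<Union>i \<in> {0..<n}. {{U i, U (i+1)}}) \<union>
             (\<Union>i \<in> {1..n-1}. {{U i, X i}, {X i, Y i}, {Y i, Z i},
                {U (i+1), X i}, {U (i+1), Y i}, {U (i+1), Z i}}) \<rparr>"

lemma finite_verts_G_graph: "finite (verts (G_graph n))"
  by (simp add: G_graph_def)

lemma simple_graph_G_graph: "simple_graph (G_graph n)"
  by (auto simp: simple_graph_def G_graph_def)

end

theory Submission
  imports Defs
begin

text \<open>
  Call \<open>{x\<^sub>i, y\<^sub>i, z\<^sub>i}\<close> a fan. Once \<open>u\<^sub>m, \<dots>, u\<^sub>k\<close> are selected, the fans \<open>m - 1, \<dots>, k - 1\<close> are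
  dominated, so to the left the only legal move is \<open>u\<^bsub>m-1\<^esub>\<close> (as long as \<open>m \<ge> 2\<close>); to the right
  there are \<open>u\<^bsub>k+1\<^esub>\<close> and the delaying move \<open>x\<^sub>k\<close>. Dominator always answers with \<open>u\<^bsub>k+1\<^esub>\<close>, so
  that each remaining fan on the right costs at most two moves and each remaining vertex on the
  left one move, at most \<open>(m - 1) + 2 (n - k)\<close> in total.
  Staller starts with \<open>u\<^sub>0\<close>, which forces \<open>u\<^sub>1\<close>, and then plays \<open>x\<^sub>k\<close> on every new fan. If
  Dominator plays \<open>x\<^sub>k\<close> or \<open>y\<^sub>k\<close> himself, the fan costs three moves, which makes up for the next
  fan, where Dominator moves first.
\<close>

section \<open>Optimal play\<close>

lemma remaining_Staller_ge:
  assumes "finite (verts G)" and "w \<in> legal_moves G S"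
  shows "1 + remaining_moves G Dominator (insert w S) \<le> remaining_moves G Staller S"
proof -
  have "finite (legal_moves G S)" using assms(1) by (simp add: legal_moves_def)
  with assms show ?thesis by (auto simp: remaining_moves.simps[of G Staller S])
qed

lemma remaining_Dominator_le:
  assumes "finite (verts G)" and "w \<in> legal_moves G S"
  shows "remaining_moves G Dominator S \<le> 1 + remaining_moves G Staller (insert w S)"
proof -
  have "finite (legal_moves G S)" using assms(1) by (simp add: legal_moves_def)
  with assms show ?thesis by (auto simp: remaining_moves.simps[of G Dominator S])
qed

lemma remaining_Staller_le:
  assumes "finite (verts G)"
    and "\<And>w. w \<in> legal_moves G S \<Longrightarrow> 1 + remaining_moves G Dominator (insert w S) \<le> b"
  shows "remaining_moves G Staller S \<le> b"
proof (cases "legal_moves G S = {}")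
  case False
  have fin: "finite (legal_moves G S)" using assms(1) by (simp add: legal_moves_def)
  let ?f = "\<lambda>w. remaining_moves G Dominator (insert w S)"
  have "Max (?f ` legal_moves G S) \<in> ?f ` legal_moves G S" using fin False by (intro Max_in) auto
  then show ?thesis using assms False by (auto simp: remaining_moves.simps[of G Staller S])
qed (simp add: remaining_moves.simps[of G Staller S])

text \<open>Without a legal move the bound on the moves would be vacuous while the value is 0, so a
  lower bound needs a move to exist. An upper bound holds trivially in that case.\<close>

lemma remaining_Dominator_ge:
  assumes "finite (verts G)" and "legal_moves G S \<noteq> {}"
    and "\<And>w. w \<in> legal_moves G S \<Longrightarrow> b \<le> 1 + remaining_moves G Staller (insert w S)"
  shows "b \<le> remaining_moves G Dominator S"
proof -
  have fin: "finite (legal_moves G S)" using assms(1) by (simp add: legal_moves_def)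
  let ?f = "\<lambda>w. remaining_moves G Staller (insert w S)"
  have "Min (?f ` legal_moves G S) \<in> ?f ` legal_moves G S" using fin assms(2) by (intro Min_in) auto
  then show ?thesis using assms by (auto simp: remaining_moves.simps[of G Dominator S])
qed

section \<open>Positions of the game\<close>

lemma mem_verts_G_graph [simp]:
  "U i \<in> verts (G_graph n) \<longleftrightarrow> i \<le> n"
  "X i \<in> verts (G_graph n) \<longleftrightarrow> 1 \<le> i \<and> i < n"
  "Y i \<in> verts (G_graph n) \<longleftrightarrow> 1 \<le> i \<and> i < n"
  "Z i \<in> verts (G_graph n) \<longleftrightarrow> 1 \<le> i \<and> i < n"
  by (auto simp: G_graph_def)

lemma edge_G_graph [simp]:
  "{U i, U j} \<in> edges (G_graph n) \<longleftrightarrow> (j = Suc i \<and> i < n) \<or> (i = Suc j \<and> j < n)"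
  "{U i, X j} \<in> edges (G_graph n) \<longleftrightarrow> (i = j \<or> i = Suc j) \<and> 1 \<le> j \<and> j < n"
  "{U i, Y j} \<in> edges (G_graph n) \<longleftrightarrow> i = Suc j \<and> 1 \<le> j \<and> j < n"
  "{U i, Z j} \<in> edges (G_graph n) \<longleftrightarrow> i = Suc j \<and> 1 \<le> j \<and> j < n"
  "{X j, U i} \<in> edges (G_graph n) \<longleftrightarrow> (i = j \<or> i = Suc j) \<and> 1 \<le> j \<and> j < n"
  "{Y j, U i} \<in> edges (G_graph n) \<longleftrightarrow> i = Suc j \<and> 1 \<le> j \<and> j < n"
  "{Z j, U i} \<in> edges (G_graph n) \<longleftrightarrow> i = Suc j \<and> 1 \<le> j \<and> j < n"
  "{X i, X j} \<notin> edges (G_graph n)"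
  "{X i, Y j} \<in> edges (G_graph n) \<longleftrightarrow> i = j \<and> 1 \<le> j \<and> j < n"
  "{Y j, X i} \<in> edges (G_graph n) \<longleftrightarrow> i = j \<and> 1 \<le> j \<and> j < n"
  "{X i, Z j} \<notin> edges (G_graph n)"
  "{Z j, X i} \<notin> edges (G_graph n)"
  "{Y i, Y j} \<notin> edges (G_graph n)"
  "{Y i, Z j} \<in> edges (G_graph n) \<longleftrightarrow> i = j \<and> 1 \<le> j \<and> j < n"
  "{Z j, Y i} \<in> edges (G_graph n) \<longleftrightarrow> i = j \<and> 1 \<le> j \<and> j < n"
  "{Z i, Z j} \<notin> edges (G_graph n)"
  by (auto simp: G_graph_def doubleton_eq_iff)

lemma mem_closed_nbhd:
  "w \<in> closed_nbhd G v \<longleftrightarrow> w \<in> verts G \<and> (w = v \<or> {v, w} \<in> edges G)"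
  by (simp add: closed_nbhd_def)

lemma mem_dominated: "v \<in> dominated G S \<longleftrightarrow> (\<exists>s\<in>S. v \<in> closed_nbhd G s)"
  by (simp add: dominated_def)

lemma dominated_insert: "dominated G (insert v S) = closed_nbhd G v \<union> dominated G S"
  by (simp add: dominated_def)

definition fan_between :: "nat \<Rightarrow> nat \<Rightarrow> vertex set" where
  "fan_between a b = X ` {a..<b} \<union> Y ` {a..<b} \<union> Z ` {a..<b}"

lemma mem_fan_between [simp]:
  "U i \<notin> fan_between a b"
  "X i \<in> fan_between a b \<longleftrightarrow> a \<le> i \<and> i < b"
  "Y i \<in> fan_between a b \<longleftrightarrow> a \<le> i \<and> i < b"
  "Z i \<in> fan_between a b \<longleftrightarrow> a \<le> i \<and> i < b"
  by (auto simp: fan_between_def)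

text \<open>Since fan \<open>m - 1\<close> is dominated by \<open>u\<^sub>m\<close>, its vertices may be among the selected ones. The
  subtraction is truncated, and fan \<open>0\<close> does not exist.\<close>

definition spine_position :: "nat \<Rightarrow> nat \<Rightarrow> nat \<Rightarrow> vertex set \<Rightarrow> bool" where
  "spine_position n m k S \<longleftrightarrow> m \<le> k \<and> 1 \<le> k \<and> k \<le> n \<and>
     U ` {m..k} \<subseteq> S \<and> S \<subseteq> U ` {m..k} \<union> fan_between (m - 1) k"

text \<open>The spine vertices alone decide what is dominated: the neighbours of a selected vertex
  of fan \<open>i\<close> lie in that fan or are \<open>U i\<close> or \<open>U (i + 1)\<close>, and
  all of these are dominated by the spine. In fan \<open>k\<close> only \<open>X k\<close> is
  adjacent to \<open>U k\<close>, hence the weak bound for \<open>X\<close> and the strict ones for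
  \<open>Y\<close> and \<open>Z\<close>.\<close>

lemma dominated_spine_position:
  assumes "spine_position n m k S"
  shows "U i \<in> dominated (G_graph n) S \<longleftrightarrow> m - 1 \<le> i \<and> i \<le> Suc k \<and> i \<le> n"
    and "X i \<in> dominated (G_graph n) S \<longleftrightarrow> m - 1 \<le> i \<and> 1 \<le> i \<and> i \<le> k \<and> i < n"
    and "Y i \<in> dominated (G_graph n) S \<longleftrightarrow> m - 1 \<le> i \<and> 1 \<le> i \<and> i < k"
    and "Z i \<in> dominated (G_graph n) S \<longleftrightarrow> m - 1 \<le> i \<and> 1 \<le> i \<and> i < k"
proof -
  note P = assms[unfolded spine_position_def]
  have U: "U j \<in> S \<longleftrightarrow> m \<le> j \<and> j \<le> k" for j
    using P by auto
  have fan: "m - 1 \<le> j \<and> j < k" if "X j \<in> S \<or> Y j \<in> S \<or> Z j \<in> S" for j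
    using P that by auto
  have dom: "v \<in> dominated (G_graph n) S" if "U j \<in> S" "v \<in> closed_nbhd (G_graph n) (U j)" for v j
    using that by (auto simp: mem_dominated)
  \<comment> \<open>Splitting by constructor lets the edge rules treat each kind of dominating
    vertex separately.\<close>
  have bex: "(\<exists>s\<in>S. Q s) \<longleftrightarrow> (\<exists>j. U j \<in> S \<and> Q (U j)) \<or> (\<exists>j. X j \<in> S \<and> Q (X j)) \<or>
      (\<exists>j. Y j \<in> S \<and> Q (Y j)) \<or> (\<exists>j. Z j \<in> S \<and> Q (Z j))" for Q
    by (metis vertex.exhaust)
  show "U i \<in> dominated (G_graph n) S \<longleftrightarrow> m - 1 \<le> i \<and> i \<le> Suc k \<and> i \<le> n" (is "?L \<longleftrightarrow> ?R")
  proof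
    assume ?L
    then show ?R using P fan by (fastforce simp: mem_dominated mem_closed_nbhd bex U)
  next
    assume R: ?R
    consider "m \<le> i" "i \<le> k" | "Suc i = m" | "i = Suc k" using R by linarith
    then show ?L
      using P R by cases (auto simp: mem_closed_nbhd U intro: dom[of i] dom[of m] dom[of k])
  qed
  show "X i \<in> dominated (G_graph n) S \<longleftrightarrow> m - 1 \<le> i \<and> 1 \<le> i \<and> i \<le> k \<and> i < n" (is "?L \<longleftrightarrow> ?R")
  proof
    assume ?L
    then show ?R using P fan by (fastforce simp: mem_dominated mem_closed_nbhd bex U)
  next
    assume R: ?R
    then consider "m \<le> i" | "i < k" "m \<le> Suc i" using P by linarith
    then show ?L
      using P R by cases (auto simp: mem_closed_nbhd U intro: dom[of i] dom[of "Suc i"])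
  qed
  show "Y i \<in> dominated (G_graph n) S \<longleftrightarrow> m - 1 \<le> i \<and> 1 \<le> i \<and> i < k" (is "?L \<longleftrightarrow> ?R")
  proof
    assume ?L
    then show ?R using P fan by (fastforce simp: mem_dominated mem_closed_nbhd bex U)
  next
    assume ?R
    then show ?L using P by (intro dom[of "Suc i"]) (auto simp: mem_closed_nbhd U)
  qed
  show "Z i \<in> dominated (G_graph n) S \<longleftrightarrow> m - 1 \<le> i \<and> 1 \<le> i \<and> i < k" (is "?L \<longleftrightarrow> ?R")
  proof
    assume ?L
    then show ?R using P fan by (fastforce simp: mem_dominated mem_closed_nbhd bex U)
  next
    assume ?R
    then show ?L using P by (intro dom[of "Suc i"]) (auto simp: mem_closed_nbhd U)
  qed
qed

text \<open>Inside the fans \<open>m - 1\<close> to \<open>k - 1\<close> nothing new can be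
  dominated, so a move must extend one of the two ends. On the right both moves gain
  \<open>Y k\<close>, even when \<open>k = n - 1\<close> and there is no further spine
  vertex.\<close>

lemma legal_moves_spine_position:
  assumes "spine_position n m k S"
  shows "w \<in> legal_moves (G_graph n) S \<longleftrightarrow>
    (2 \<le> m \<and> w = U (m - 1)) \<or> (k < n \<and> (w = U (Suc k) \<or> w = X k))" (is "?L \<longleftrightarrow> ?R")
proof
  note P = assms[unfolded spine_position_def]
  note dom = dominated_spine_position[OF assms]
  assume ?L
  then have w: "w \<in> verts (G_graph n)" by (simp add: legal_moves_def)
  from \<open>?L\<close> obtain v where v: "v \<in> verts (G_graph n)" "w = v \<or> {w, v} \<in> edges (G_graph n)"
      "v \<notin> dominated (G_graph n) S"
    unfolding legal_moves_def closed_nbhd_def by blast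
  have "S \<noteq> {}" using P by auto
  with \<open>?L\<close> obtain s where s: "s \<in> S" "{s, w} \<in> edges (G_graph n)"
    unfolding legal_moves_def by blast
  have wS: "w \<notin> S"
    using v by (auto simp: mem_dominated mem_closed_nbhd)
  have fan: "X j \<in> S \<Longrightarrow> m - 1 \<le> j \<and> j < k" "Y j \<in> S \<Longrightarrow> m - 1 \<le> j \<and> j < k"
    "Z j \<in> S \<Longrightarrow> m - 1 \<le> j \<and> j < k" for j
    using P by auto
  have U_in: "U j \<in> S \<longleftrightarrow> m \<le> j \<and> j \<le> k" for j
    using P by auto
  show ?R
  proof (cases w)
    case (U i)
    have "m - 1 \<le> i \<and> i \<le> Suc k"
      using s by (cases s) (auto simp: U U_in dest: fan)
    moreover have "i < m \<or> k < i"
      using wS by (auto simp: U U_in)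
    ultimately have "(m = Suc i) \<or> i = Suc k" by linarith
    \<comment> \<open>For \<open>m = 1\<close>, the vertex \<open>U 1\<close> already dominates the
      whole closed neighbourhood of \<open>U 0\<close>.\<close>
    moreover have "i \<noteq> 0" if "m = Suc i"
      using v P that by (cases v) (auto simp: U dom)
    ultimately show ?thesis using U w by auto
  next
    case (X i)
    have "m - 1 \<le> i \<and> i \<le> k" "1 \<le> i" "i < n"
      using s w by (cases s; auto simp: X U_in dest: fan)+
    moreover have "\<not> i < k"
      using v P calculation by (cases v) (auto simp: X dom)
    ultimately show ?thesis using X by auto
  next
    case (Y i)
    have "m - 1 \<le> i \<and> i < k" "1 \<le> i"
      using s w by (cases s; auto simp: Y U_in dest: fan)+
    then show ?thesis using v P by (cases v) (auto simp: Y dom)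
  next
    case (Z i)
    have "m - 1 \<le> i \<and> i < k" "1 \<le> i"
      using s w by (cases s; auto simp: Z U_in dest: fan)+
    then show ?thesis using v P by (cases v) (auto simp: Z dom)
  qed
next
  note P = assms[unfolded spine_position_def]
  note dom = dominated_spine_position[OF assms]
  assume ?R
  then consider "2 \<le> m" "w = U (m - 1)" | "k < n" "w = U (Suc k)" | "k < n" "w = X k" by blast
  then show ?L
  proof cases
    case 1
    have "U (m - 2) \<in> closed_nbhd (G_graph n) w" "U (m - 2) \<notin> dominated (G_graph n) S"
      "U m \<in> S" "{U m, w} \<in> edges (G_graph n)" "w \<in> verts (G_graph n)"
      using 1 P by (auto simp: mem_closed_nbhd dom)
    then show ?thesis by (auto simp: legal_moves_def)
  next
    case 2
    have "Y k \<in> closed_nbhd (G_graph n) w" "Y k \<notin> dominated (G_graph n) S"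
      "U k \<in> S" "{U k, w} \<in> edges (G_graph n)" "w \<in> verts (G_graph n)"
      using 2 P by (auto simp: mem_closed_nbhd dom)
    then show ?thesis by (auto simp: legal_moves_def)
  next
    case 3
    have "Y k \<in> closed_nbhd (G_graph n) w" "Y k \<notin> dominated (G_graph n) S"
      "U k \<in> S" "{U k, w} \<in> edges (G_graph n)" "w \<in> verts (G_graph n)"
      using 3 P by (auto simp: mem_closed_nbhd dom)
    then show ?thesis by (auto simp: legal_moves_def)
  qed
qed

text \<open>This concerns the shape of the set, not legality: \<open>m = 1\<close> is allowed, so
  that the position after the opening \<open>U 0\<close>, \<open>U 1\<close> is covered too.\<close>

lemma spine_position_advance_left:
  assumes "spine_position n m k S" and "1 \<le> m"
  shows "spine_position n (m - 1) k (insert (U (m - 1)) S)"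
proof -
  have "{m - 1..k} = insert (m - 1) {m..k}"
    using assms by (auto simp: spine_position_def)
  moreover have "fan_between (m - 1) k \<subseteq> fan_between (m - 1 - 1) k"
    by (auto simp: fan_between_def)
  ultimately show ?thesis
    using assms by (auto simp: spine_position_def)
qed

text \<open>\<open>T\<close> collects the delaying moves made in fan \<open>k\<close> before
  \<open>U (Suc k)\<close>. Afterwards they no longer matter.\<close>

lemma spine_position_advance_right:
  assumes "spine_position n m k S" and "k < n" and "T \<subseteq> {X k, Y k, Z k}"
  shows "spine_position n m (Suc k) (insert (U (Suc k)) (S \<union> T))"
proof -
  note P = assms(1)[unfolded spine_position_def]
  have spine: "U ` {m..Suc k} = insert (U (Suc k)) (U ` {m..k})"
    using P by (simp add: atLeastAtMostSuc_conv)
  have "S \<subseteq> U ` {m..k} \<union> fan_between (m - 1) k"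
    using P by simp
  also have "\<dots> \<subseteq> U ` {m..k} \<union> fan_between (m - 1) (Suc k)"
    by (auto simp: fan_between_def)
  finally have "S \<subseteq> U ` {m..k} \<union> fan_between (m - 1) (Suc k)" .
  moreover have "T \<subseteq> fan_between (m - 1) (Suc k)"
    using P by (intro subset_trans[OF assms(3)]) auto
  ultimately have "insert (U (Suc k)) (S \<union> T) \<subseteq> U ` {m..Suc k} \<union> fan_between (m - 1) (Suc k)"
    unfolding spine by simp blast
  moreover have "U ` {m..Suc k} \<subseteq> insert (U (Suc k)) (S \<union> T)"
    using P unfolding spine by (intro insert_mono le_supI1) simp
  ultimately show ?thesis
    using P assms(2) unfolding spine_position_def by simp
qed

text \<open>\<open>X k\<close> misses \<open>Z k\<close>, so the advance still dominates something
  new.\<close>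

lemma legal_advance_after_X:
  assumes "spine_position n m k S" and "k < n"
  shows "U (Suc k) \<in> legal_moves (G_graph n) (insert (X k) S)"
proof -
  note P = assms(1)[unfolded spine_position_def]
  have "Z k \<in> closed_nbhd (G_graph n) (U (Suc k))" "Z k \<notin> dominated (G_graph n) (insert (X k) S)"
    "{X k, U (Suc k)} \<in> edges (G_graph n)"
    using P assms(2) dominated_spine_position(4)[OF assms(1)]
    by (auto simp: mem_closed_nbhd dominated_insert)
  then show ?thesis using assms(2) by (auto simp: legal_moves_def)
qed

text \<open>Now fan \<open>k\<close> is fully dominated, and the advance gains only
  \<open>U (Suc (Suc k))\<close>, which must therefore exist.\<close>

lemma legal_advance_after_XY:
  assumes "spine_position n m k S" and "Suc k < n"
  shows "U (Suc k) \<in> legal_moves (G_graph n) (insert (Y k) (insert (X k) S))"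
proof -
  note P = assms(1)[unfolded spine_position_def]
  have "U (Suc (Suc k)) \<in> closed_nbhd (G_graph n) (U (Suc k))"
    "U (Suc (Suc k)) \<notin> dominated (G_graph n) (insert (Y k) (insert (X k) S))"
    "{X k, U (Suc k)} \<in> edges (G_graph n)"
    using P assms(2) dominated_spine_position(1)[OF assms(1)]
    by (auto simp: mem_closed_nbhd dominated_insert)
  then show ?thesis using assms(2) by (auto simp: legal_moves_def)
qed

text \<open>The dominated set has only grown, so a move that was not legal before must be a
  neighbour of \<open>X k\<close>. With \<open>m = 0\<close> there are no moves on the left.\<close>

lemma legal_moves_after_X:
  assumes "spine_position n 0 k S" and "k < n"
    and "w \<in> legal_moves (G_graph n) (insert (X k) S)"
  shows "w = U (Suc k) \<or> w = Y k"
proof (cases "w \<in> legal_moves (G_graph n) S")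
  case True
  then have "w = U (Suc k) \<or> w = X k"
    using legal_moves_spine_position[OF assms(1)] by auto
  then show ?thesis using assms(3) by (auto simp: legal_moves_def dominated_def)
next
  case False
  have "S \<noteq> {}" using assms(1) by (auto simp: spine_position_def)
  then have "{X k, w} \<in> edges (G_graph n)"
    using False assms(3) by (auto simp: legal_moves_def dominated_def)
  moreover have "U k \<in> S" using assms(1) by (auto simp: spine_position_def)
  then have "w \<noteq> U k" using assms(3) by (auto simp: legal_moves_def dominated_def)
  ultimately show ?thesis by (cases w) auto
qed

section \<open>Dominator's strategy\<close>

text \<open>The bound is the same for both players, so the induction need not track whose turn it
  is. A left move uses up its budget of one; an advance on the right takes one move of a budget of
  two, and \<open>X k\<close> with its answer takes exactly two.\<close>

lemma remaining_moves_le: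
  assumes "spine_position n m k S"
  shows "remaining_moves (G_graph n) p S \<le> (m - 1) + 2 * (n - k)"
  using assms
proof (induction "m + (n - k)" arbitrary: m k S p rule: less_induct)
  case less
  note legal = legal_moves_spine_position[OF less.prems]
  note fin = finite_verts_G_graph[of n]
  have left: "remaining_moves (G_graph n) q (insert (U (m - 1)) S) \<le> (m - 1 - 1) + 2 * (n - k)"
    if "2 \<le> m" for q
    using that less.prems by (intro less.hyps spine_position_advance_left) auto
  have right: "remaining_moves (G_graph n) q (insert (U (Suc k)) (S \<union> T))
      \<le> (m - 1) + 2 * (n - Suc k)"
    if "k < n" "T \<subseteq> {X k, Y k, Z k}" for q T
    using that less.prems by (intro less.hyps spine_position_advance_right) auto
  show ?case
  proof (cases p)
    case Staller
    show ?thesis unfolding Staller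
    proof (rule remaining_Staller_le[OF fin])
      fix w assume "w \<in> legal_moves (G_graph n) S"
      then consider "2 \<le> m" "w = U (m - 1)" | "k < n" "w = U (Suc k)" | "k < n" "w = X k"
        using legal by blast
      then show "1 + remaining_moves (G_graph n) Dominator (insert w S) \<le> (m - 1) + 2 * (n - k)"
      proof cases
        case 1
        with left[of Dominator] show ?thesis by simp
      next
        case 2
        with right[of "{}" Dominator] show ?thesis by simp
      next
        case 3
        with remaining_Dominator_le[OF fin legal_advance_after_X[OF less.prems]]
          right[of "{X k}" Staller]
        show ?thesis by simp
      qed
    qed
  next
    case Dominator
    show ?thesis
    proof (cases "k < n")
      case True
      then have "U (Suc k) \<in> legal_moves (G_graph n) S" using legal by blast
      with True remaining_Dominator_le[OF fin this] right[of "{}" Staller]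
      show ?thesis by (simp add: Dominator)
    next
      case False
      show ?thesis
      proof (cases "2 \<le> m")
        case True
        then have "U (m - 1) \<in> legal_moves (G_graph n) S" using legal by blast
        with True remaining_Dominator_le[OF fin this] left[of Staller]
        show ?thesis by (simp add: Dominator)
      next
        case False
        then have "legal_moves (G_graph n) S = {}" using \<open>\<not> k < n\<close> legal by blast
        then show ?thesis by (simp add: remaining_moves.simps)
      qed
    qed
  qed
qed

section \<open>Staller's strategy\<close>

text \<open>Having Dominator to move costs Staller at most one move over all remaining fans
  together, not one per fan.\<close>

lemma remaining_moves_ge:
  assumes "spine_position n 0 k S"
  shows "2 * (n - k) \<le> remaining_moves (G_graph n) Staller S \<and>
    2 * (n - k) - 1 \<le> remaining_moves (G_graph n) Dominator S"
  using assms
proof (induction "n - k" arbitrary: k S rule: less_induct)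
  case less
  note legal = legal_moves_spine_position[OF less.prems]
  note fin = finite_verts_G_graph[of n]
  show ?case
  proof (cases "k < n")
    case True
    have IH: "2 * (n - Suc k) \<le> remaining_moves (G_graph n) Staller (insert (U (Suc k)) (S \<union> T)) \<and>
        2 * (n - Suc k) - 1 \<le> remaining_moves (G_graph n) Dominator (insert (U (Suc k)) (S \<union> T))"
      if "T \<subseteq> {X k, Y k, Z k}" for T
      using that True less.prems by (intro less.hyps spine_position_advance_right) auto
    let ?S' = "insert (X k) S"
    \<comment> \<open>Staller's advance is a third move in fan \<open>k\<close> and offsets the loss
      of one from leaving Dominator to move. In the last fan it may be illegal, but there the bound
      is 0.\<close>
    have XY: "2 * (n - Suc k) \<le> remaining_moves (G_graph n) Staller (insert (Y k) ?S')"
    proof (cases "Suc k < n")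
      case True
      have "2 * (n - Suc k) - 1 \<le>
          remaining_moves (G_graph n) Dominator (insert (U (Suc k)) (insert (Y k) ?S'))"
        using IH[of "{X k, Y k}"] by (simp add: insert_commute)
      with remaining_Staller_ge[OF fin legal_advance_after_XY[OF less.prems True]]
      show ?thesis by linarith
    qed simp
    have "2 * (n - k) - 1 \<le> remaining_moves (G_graph n) Dominator ?S'"
    proof (rule remaining_Dominator_ge[OF fin])
      show "legal_moves (G_graph n) ?S' \<noteq> {}"
        using legal_advance_after_X[OF less.prems True] by blast
      fix w assume "w \<in> legal_moves (G_graph n) ?S'"
      then consider "w = U (Suc k)" | "w = Y k"
        using legal_moves_after_X[OF less.prems True] by blast
      then show "2 * (n - k) - 1 \<le> 1 + remaining_moves (G_graph n) Staller (insert w ?S')"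
        using IH[of "{X k}"] XY True by cases auto
    qed
    moreover have "X k \<in> legal_moves (G_graph n) S" using legal True by blast
    ultimately have S: "2 * (n - k) \<le> remaining_moves (G_graph n) Staller S"
      using remaining_Staller_ge[OF fin, of "X k" S] True by linarith
    \<comment> \<open>If Dominator himself plays \<open>X k\<close>, Staller advances: the fan takes
      two moves, Dominator is to move again, and the deficit of one is merely passed on.\<close>
    have X: "2 * (n - k) - 1 \<le> 1 + remaining_moves (G_graph n) Staller ?S'"
      using remaining_Staller_ge[OF fin legal_advance_after_X[OF less.prems True]]
        IH[of "{X k}"] True by simp linarith
    have "2 * (n - k) - 1 \<le> remaining_moves (G_graph n) Dominator S"
    proof (rule remaining_Dominator_ge[OF fin])
      show "legal_moves (G_graph n) S \<noteq> {}" using legal True by blast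
      fix w assume "w \<in> legal_moves (G_graph n) S"
      then consider "w = U (Suc k)" | "w = X k" using legal by auto
      then show "2 * (n - k) - 1 \<le> 1 + remaining_moves (G_graph n) Staller (insert w S)"
        using IH[of "{}"] X True by cases auto
    qed
    with S show ?thesis ..
  qed simp
qed

section \<open>The first moves\<close>

lemma legal_moves_empty:
  "legal_moves (G_graph n) {} = verts (G_graph n)"
  by (auto simp: legal_moves_def dominated_def mem_closed_nbhd)

lemma spine_position_singleton:
  assumes "1 \<le> m" and "m \<le> n"
  shows "spine_position n m m {U m}"
  using assms by (simp add: spine_position_def)

lemma spine_position_start: "1 \<le> n \<Longrightarrow> spine_position n 0 1 {U 1, U 0}"
  using spine_position_advance_left[OF spine_position_singleton[of 1 n]] by (simp add: insert_commute)

text \<open>\<open>{U 0}\<close> is not a spine position, as those require \<open>1 \<le> k\<close>,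
  so this opening is treated by hand.\<close>

lemma legal_moves_U0:
  assumes "2 \<le> n"
  shows "legal_moves (G_graph n) {U 0} = {U 1}"
proof -
  have "w = U 1" if "w \<in> legal_moves (G_graph n) {U 0}" for w
    using that by (cases w) (auto simp: legal_moves_def)
  moreover have "U 1 \<in> legal_moves (G_graph n) {U 0}"
  proof -
    have "U 2 \<in> closed_nbhd (G_graph n) (U 1)" "U 2 \<notin> closed_nbhd (G_graph n) (U 0)"
      using assms by (auto simp: mem_closed_nbhd)
    then show ?thesis using assms by (auto simp: legal_moves_def dominated_def)
  qed
  ultimately show ?thesis by blast
qed

text \<open>Dominator answers with \<open>U (Suc i)\<close>. The result is a spine position because
  fan \<open>m - 1\<close> may contain selected vertices.\<close>

lemma remaining_after_fan_start:
  assumes "1 \<le> i" and "i < n" and "v \<in> {X i, Y i, Z i}"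
  shows "remaining_moves (G_graph n) Dominator {v} \<le> 2 * n - 1"
proof -
  have "U (Suc i) \<in> closed_nbhd (G_graph n) (U (Suc i))" "{v, U (Suc i)} \<in> edges (G_graph n)"
    using assms by (auto simp: mem_closed_nbhd)
  \<comment> \<open>\<open>X i\<close> misses \<open>Z i\<close>, while \<open>Y i\<close> and
    \<open>Z i\<close> miss \<open>U i\<close>.\<close>
  moreover have "U i \<notin> closed_nbhd (G_graph n) v \<or> Z i \<notin> closed_nbhd (G_graph n) v"
    "U i \<in> closed_nbhd (G_graph n) (U (Suc i))" "Z i \<in> closed_nbhd (G_graph n) (U (Suc i))"
    using assms by (auto simp: mem_closed_nbhd)
  ultimately have "U (Suc i) \<in> legal_moves (G_graph n) {v}"
    using assms(2) by (auto simp: legal_moves_def dominated_def)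
  moreover have "spine_position n (Suc i) (Suc i) {U (Suc i), v}"
    using assms by (auto simp: spine_position_def)
  ultimately show ?thesis
    using remaining_Dominator_le[OF finite_verts_G_graph, of "U (Suc i)" n "{v}"]
      remaining_moves_le[of n "Suc i" "Suc i" "{U (Suc i), v}" Staller] assms by simp
qed

theorem lemma3p4:
  fixes n :: nat
  assumes "n \<ge> 2"
  shows "gamma_cg' (G_graph n) = 2 * n"
proof (rule antisym)
  note fin = finite_verts_G_graph[of n]
  have start: "spine_position n 0 1 {U 1, U 0}" using assms spine_position_start[of n] by simp
  have U0: "remaining_moves (G_graph n) Dominator {U 0}
      = 1 + remaining_moves (G_graph n) Staller {U 1, U 0}"
    using fin legal_moves_U0[OF assms] by (simp add: remaining_moves.simps[of _ Dominator "{U 0}"])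
  show "gamma_cg' (G_graph n) \<le> 2 * n"
    unfolding gamma_cg'_def
  proof (rule remaining_Staller_le[OF fin])
    fix w assume "w \<in> legal_moves (G_graph n) {}"
    then have w: "w \<in> verts (G_graph n)" by (simp add: legal_moves_def)
    have "remaining_moves (G_graph n) Dominator {w} \<le> 2 * n - 1"
    \<comment> \<open>The estimate is sharp only for \<open>U 0\<close>. After \<open>U m\<close>
      with \<open>m \<ge> 1\<close> at most \<open>2 * n - m - 1\<close> moves remain, and after a
      start in fan \<open>i\<close> at most \<open>2 * n - i - 1\<close>.\<close>
    proof (cases w)
      case (U m)
      show ?thesis
      proof (cases "m = 0")
        case True
        then show ?thesis
          using U U0 remaining_moves_le[OF start, of Staller] assms by simp
      next
        case False
        then show ?thesis
          using U w remaining_moves_le[OF spine_position_singleton[of m n], of Dominator] by simp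
      qed
    qed (use w remaining_after_fan_start in auto)
    then show "1 + remaining_moves (G_graph n) Dominator {w} \<le> 2 * n" using assms by simp
  qed
  have "U 0 \<in> legal_moves (G_graph n) {}" using assms by (simp add: legal_moves_empty)
  \<comment> \<open>\<open>U 0\<close> and the forced \<open>U 1\<close> are two moves; Staller is
    then to move at \<open>k = 1\<close>, with \<open>2 * (n - 1)\<close> more guaranteed.\<close>
  from remaining_Staller_ge[OF fin this]
  show "2 * n \<le> gamma_cg' (G_graph n)"
    using U0 remaining_moves_ge[OF start] assms
    by (simp add: gamma_cg'_def) linarith
qed

end
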